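(* Let $p$ be a prime and let $f(n)=(a_1n+b_1)(a_2n+b_2)\cdots(a_rn+b_r)$, where $a_i,b_i\in\mathbb{Z}$, $a_i\neq 0$, and $\gcd(a_i,b_i)=1$ for all $1\le i\le r$. Then the number of infinite branches of the $p$-adic valuation tree of $\{\nu_p(f(n))\}_{n\ge 0}$ equals the number of distinct $p$-adic integer roots of $f$. Moreover, the form of each infinite branch corresponds to the $p$-adic expansion of one of these roots.
   Context: For a prime $p$, $\nu_p$ is the usual $p$-adic valuation on $\mathbb{Q}$, with $\nu_p(0)=+\infty$; $p$-adic integers are the elements of $\mathbb{Z}_p$. Valuation tree. Given a sequence of rational numbers $\{S_n\}_{n\ge 0}$, the $p$-adic valuation tree of $\{\nu_p(S_n)\}_{n\ge 0}$ is built as follows. The $0$-th level has a single node, containing all terms of the sequence. A node at level $k$ consists of the terms $S_m$ whose index $m$ has the form $m=c_0+c_1p+\cdots+c_{k-1}p^{k-1}+np^k$, $n\ge 0$, for fixed digits $0\le c_i\le p-1$. A node is terminating if $\nu_p(S_m)$ has the same value for all terms $S_m$ in the node; it is non-terminating if at least two terms in the node have different valuations. A terminating node does not split. A non-terminating node at level $k$ splits into the $p$ nodes at level $k+1$ whose indices are $m=c_0+\cdots+c_{k-1}p^{k-1}+c_kp^k+np^{k+1}$, $n\ge 0$, one for each $0\le c_k\le p-1$. An infinite branch is a path of non-terminating nodes from the $0$-th level passing through every level, each node being one of the nodes into which the previous one splits. An infinite branch corresponds to the $p$-adic expansion $c_0+c_1p+c_2p^2+\cdots$ ($0\le c_i\le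 p-1$) if for every $k\ge 0$ its node at level $k$ is the one with indices $c_0+c_1p+\cdots+c_{k-1}p^{k-1}+np^k$. *)

theory Defs
  imports
    "HOL-Computational_Algebra.Polynomial"
    "HOL-Computational_Algebra.Primes"
    "HOL-Algebra.Ring"
    "HOL-Library.Extended"
begin

section \<open>The $p$-adic valuation on the rationals\<close>

definition padic_valuation :: "nat \<Rightarrow> rat \<Rightarrow> int extended" where
  "padic_valuation p q =
     (if q = 0 then \<infinity>
      else case quotient_of q of (a, b) \<Rightarrow>
        Fin (int (multiplicity (int p) a) - int (multiplicity (int p) b)))"


section \<open>The valuation tree of a sequence\<close>

text \<open>
  A node at level \<open>k\<close> is addressed by the list \<open>[c\<^sub>0, \<dots>, c\<^bsub>k-1\<^esub>]\<close> of its fixed digits; the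
  terms it contains are those with index in \<open>node_indices p [c\<^sub>0, \<dots>, c\<^bsub>k-1\<^esub>]\<close>.  For digits
  below \<open>p\<close>, distinct lists have distinct index sets.
\<close>

definition node_indices :: "nat \<Rightarrow> nat list \<Rightarrow> nat set" where
  "node_indices p cs = {(\<Sum>i<length cs. cs ! i * p ^ i) + n * p ^ length cs | n. True}"

definition terminating :: "nat \<Rightarrow> (nat \<Rightarrow> rat) \<Rightarrow> nat list \<Rightarrow> bool" where
  "terminating p S cs \<longleftrightarrow>
     (\<forall>m \<in> node_indices p cs. \<forall>m' \<in> node_indices p cs.
        padic_valuation p (S m) = padic_valuation p (S m'))"

inductive_set valuation_tree :: "nat \<Rightarrow> (nat \<Rightarrow> rat) \<Rightarrow> nat list set"
  for p :: nat and S :: "nat \<Rightarrow> rat" where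
  root: "[] \<in> valuation_tree p S"
| split: "cs \<in> valuation_tree p S \<Longrightarrow> \<not> terminating p S cs \<Longrightarrow> c < p
            \<Longrightarrow> cs @ [c] \<in> valuation_tree p S"

text \<open>A branch \<open>N\<close> is given by its nodes: \<open>N k\<close> is the node at level \<open>k\<close>.\<close>

definition infinite_branches :: "nat \<Rightarrow> (nat \<Rightarrow> rat) \<Rightarrow> (nat \<Rightarrow> nat list) set" where
  "infinite_branches p S =
     {N. N 0 = [] \<and>
         (\<forall>k. N k \<in> valuation_tree p S \<and> \<not> terminating p S (N k) \<and>
              (\<exists>c<p. N (Suc k) = N k @ [c]))}"

definition branch_corresponds :: "nat \<Rightarrow> (nat \<Rightarrow> nat list) \<Rightarrow> (nat \<Rightarrow> nat) \<Rightarrow> bool" where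
  "branch_corresponds p N c \<longleftrightarrow>
     (\<forall>k. node_indices p (N k) = {(\<Sum>i<k. c i * p ^ i) + n * p ^ k | n. True})"


section \<open>The ring of $p$-adic integers\<close>

text \<open>
  \<open>\<int>\<^sub>p\<close> is the inverse limit of the rings \<open>\<int>/p\<^sup>k\<int>\<close>: an element \<open>x\<close> is a compatible sequence
  whose entry \<open>x k\<close> is the representative in \<open>{0..<p\<^sup>k}\<close> of its residue class modulo \<open>p\<^sup>k\<close>.
\<close>

definition padic_int :: "nat \<Rightarrow> (nat \<Rightarrow> int) ring" where
  "padic_int p =
     \<lparr> carrier = {x. \<forall>k. x k \<in> {0..<int p ^ k} \<and> x (Suc k) mod int p ^ k = x k},
       monoid.mult = (\<lambda>x y k. (x k * y k) mod int p ^ k),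
       one = (\<lambda>k. 1 mod int p ^ k),
       zero = (\<lambda>k. 0),
       add = (\<lambda>x y k. (x k + y k) mod int p ^ k) \<rparr>"

lemma cring_padic_int:
  assumes "p > 0"
  shows "cring (padic_int p)"
proof -
  have pos: "int p ^ k > 0" for k
    using assms by simp
  have mod_mod: "a mod int p ^ Suc k mod int p ^ k = a mod int p ^ k" for a k
    by (simp add: mod_mod_cancel)
  have step: "x k = x (Suc k) mod int p ^ k" if "x \<in> carrier (padic_int p)" for x k
    using that by (simp add: padic_int_def)
  have small: "x k mod int p ^ k = x k" if "x \<in> carrier (padic_int p)" for x k
    using that by (simp add: padic_int_def)
  have closed: "(\<lambda>k. g k mod int p ^ k) \<in> carrier (padic_int p)"
    if "\<And>k. g (Suc k) mod int p ^ k = g k mod int p ^ k" for g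
    using that pos mod_mod by (simp add: padic_int_def)
  have add: "x \<oplus>\<^bsub>padic_int p\<^esub> y = (\<lambda>k. (x k + y k) mod int p ^ k)"
    and mult: "x \<otimes>\<^bsub>padic_int p\<^esub> y = (\<lambda>k. (x k * y k) mod int p ^ k)"
    and zero: "\<zero>\<^bsub>padic_int p\<^esub> = (\<lambda>k. 0)"
    and one: "\<one>\<^bsub>padic_int p\<^esub> = (\<lambda>k. 1 mod int p ^ k)" for x y
    by (simp_all add: padic_int_def)
  have add_closed: "x \<oplus>\<^bsub>padic_int p\<^esub> y \<in> carrier (padic_int p)"
    if "x \<in> carrier (padic_int p)" "y \<in> carrier (padic_int p)" for x y
    unfolding add by (rule closed) (metis step that mod_add_eq)
  have mult_closed: "x \<otimes>\<^bsub>padic_int p\<^esub> y \<in> carrier (padic_int p)"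
    if "x \<in> carrier (padic_int p)" "y \<in> carrier (padic_int p)" for x y
    unfolding mult by (rule closed) (metis step that mod_mult_eq)
  have neg: "\<exists>y \<in> carrier (padic_int p). y \<oplus>\<^bsub>padic_int p\<^esub> x = \<zero>\<^bsub>padic_int p\<^esub>"
    if "x \<in> carrier (padic_int p)" for x
  proof
    show "(\<lambda>k. (- x k) mod int p ^ k) \<in> carrier (padic_int p)"
      by (rule closed) (metis step that mod_minus_eq)
    show "(\<lambda>k. (- x k) mod int p ^ k) \<oplus>\<^bsub>padic_int p\<^esub> x = \<zero>\<^bsub>padic_int p\<^esub>"
      unfolding add zero by (simp add: mod_simps)
  qed
  show ?thesis
  proof (intro cringI abelian_groupI comm_monoidI)
    show "\<zero>\<^bsub>padic_int p\<^esub> \<in> carrier (padic_int p)"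
      using closed[of "\<lambda>_. 0"] by (simp add: zero)
    show "\<one>\<^bsub>padic_int p\<^esub> \<in> carrier (padic_int p)"
      unfolding one by (rule closed) (simp add: mod_mod_cancel)
  next
    fix x y z
    assume "x \<in> carrier (padic_int p)" "y \<in> carrier (padic_int p)" "z \<in> carrier (padic_int p)"
    show "(x \<oplus>\<^bsub>padic_int p\<^esub> y) \<oplus>\<^bsub>padic_int p\<^esub> z = x \<oplus>\<^bsub>padic_int p\<^esub> (y \<oplus>\<^bsub>padic_int p\<^esub> z)"
      by (simp add: add mod_simps add.assoc)
    show "(x \<otimes>\<^bsub>padic_int p\<^esub> y) \<otimes>\<^bsub>padic_int p\<^esub> z = x \<otimes>\<^bsub>padic_int p\<^esub> (y \<otimes>\<^bsub>padic_int p\<^esub> z)"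
      by (simp add: mult mod_simps mult.assoc)
    show "(x \<oplus>\<^bsub>padic_int p\<^esub> y) \<otimes>\<^bsub>padic_int p\<^esub> z =
        x \<otimes>\<^bsub>padic_int p\<^esub> z \<oplus>\<^bsub>padic_int p\<^esub> y \<otimes>\<^bsub>padic_int p\<^esub> z"
      by (simp add: add mult mod_simps distrib_right)
  next
    fix x y
    assume xy: "x \<in> carrier (padic_int p)" "y \<in> carrier (padic_int p)"
    show "x \<oplus>\<^bsub>padic_int p\<^esub> y = y \<oplus>\<^bsub>padic_int p\<^esub> x"
      by (simp add: add add.commute)
    show "x \<otimes>\<^bsub>padic_int p\<^esub> y = y \<otimes>\<^bsub>padic_int p\<^esub> x"
      by (simp add: mult mult.commute)
  next
    fix x
    assume x: "x \<in> carrier (padic_int p)"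
    show "\<zero>\<^bsub>padic_int p\<^esub> \<oplus>\<^bsub>padic_int p\<^esub> x = x"
      by (simp add: add zero small[OF x])
    show "\<one>\<^bsub>padic_int p\<^esub> \<otimes>\<^bsub>padic_int p\<^esub> x = x"
      by (simp add: mult one mod_simps small[OF x])
  qed (fact add_closed mult_closed neg)+
qed

text \<open>Evaluation of a polynomial with integer coefficients at an element of a ring.\<close>

definition int_poly_eval :: "('a, 'm) ring_scheme \<Rightarrow> int poly \<Rightarrow> 'a \<Rightarrow> 'a" where
  "int_poly_eval R f x =
     (\<Oplus>\<^bsub>R\<^esub>i \<in> {..degree f}. [coeff f i] \<cdot>\<^bsub>R\<^esub> (x [^]\<^bsub>R\<^esub> i))"

definition padic_int_roots :: "nat \<Rightarrow> int poly \<Rightarrow> (nat \<Rightarrow> int) set" where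
  "padic_int_roots p f =
     {x \<in> carrier (padic_int p). int_poly_eval (padic_int p) f x = \<zero>\<^bsub>padic_int p\<^esub>}"

text \<open>
  \<open>x = c\<^sub>0 + c\<^sub>1 p + c\<^sub>2 p\<^sup>2 + \<dots>\<close> in \<open>\<int>\<^sub>p\<close>: the \<open>k\<close>-th partial sum, which lies in \<open>{0..<p\<^sup>k}\<close>, is
  the residue of \<open>x\<close> modulo \<open>p\<^sup>k\<close>.
\<close>

definition padic_expansion :: "nat \<Rightarrow> (nat \<Rightarrow> int) \<Rightarrow> (nat \<Rightarrow> nat) \<Rightarrow> bool" where
  "padic_expansion p x c \<longleftrightarrow>
     (\<forall>i. c i < p) \<and> (\<forall>k. x k = int (\<Sum>i<k. c i * p ^ i))"

end

theory Submission
  imports Defs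
begin

text \<open>
  A sequence \<open>c\<close> of digits below \<open>p\<close> determines both the \<open>p\<close>-adic integer \<open>x = \<Sum>i. c i * p ^ i\<close>
  and the path through the nodes with addresses \<open>[c 0, \<dots>, c (k - 1)]\<close>.  The node at level \<open>k\<close> of
  this path consists of indices congruent to \<open>x\<close> modulo \<open>p ^ k\<close>.

  If \<open>x\<close> is not a root of \<open>f\<close>, then \<open>p ^ k\<close> does not divide \<open>f(x)\<close> for some \<open>k\<close>; all \<open>m\<close> in the node
  at level \<open>k\<close> satisfy \<open>f(m) \<equiv> f(x)\<close> modulo \<open>p ^ k\<close>, hence their values have the same valuation, less
  than \<open>k\<close>, and the node terminates.  If \<open>x\<close> is a root of \<open>f \<noteq> 0\<close>, then every node on the path
  contains the partial sums of \<open>x\<close> of all high orders, where the valuation of \<open>f\<close> is arbitrarily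
  large, but also, being infinite, an index that is not a zero of \<open>f\<close>, where the valuation is
  finite; so no node on the path terminates.  Hence for every \<open>f \<noteq> 0\<close> the infinite branches
  correspond bijectively to the roots of \<open>f\<close> in \<open>\<int>\<^sub>p\<close>
  (\<open>infinite_branches_eq\<close>, \<open>padic_int_roots_eq_image\<close>).

  The factorization of \<open>f\<close> into linear factors serves only to show that there are finitely many
  roots: \<open>\<int>\<^sub>p\<close> has no zero divisors (\<open>padic_int_roots_mult\<close>), and a factor \<open>a x + b\<close> with
  \<open>gcd a b = 1\<close> has at most one root, since it has none if \<open>p\<close> divides \<open>a\<close>.
\<close>

section \<open>Roots in the \<open>p\<close>-adic integers as divisibility conditions\<close>

lemma padic_int_carrier_iff:
  "x \<in> carrier (padic_int p) \<longleftrightarrow>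
    (\<forall>k. 0 \<le> x k \<and> x k < int p ^ k \<and> x (Suc k) mod int p ^ k = x k)"
  by (simp add: padic_int_def)

lemma padic_int_component_mod:
  assumes "x \<in> carrier (padic_int p)"
  shows "x k mod int p ^ k = x k"
  using assms by (simp add: padic_int_carrier_iff)

lemma padic_int_coherent:
  assumes x: "x \<in> carrier (padic_int p)" and "k \<le> l"
  shows "int p ^ k dvd x l - x k"
  using \<open>k \<le> l\<close>
proof (induction l rule: dec_induct)
  case base
  show ?case by simp
next
  case (step l)
  have "x (Suc l) mod int p ^ l = x l mod int p ^ l"
    using x by (simp add: padic_int_carrier_iff)
  then have "int p ^ l dvd x (Suc l) - x l"
    by (simp add: mod_eq_dvd_iff)
  then have "int p ^ k dvd x (Suc l) - x l"
    using step.hyps by (meson dvd_trans le_imp_power_dvd)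
  from dvd_add[OF this step.IH] show ?case by simp
qed

lemma padic_int_nat_pow_component:
  assumes "x \<in> carrier (padic_int p)"
  shows "(x [^]\<^bsub>padic_int p\<^esub> (n :: nat)) k = x k ^ n mod int p ^ k"
proof (induction n)
  case 0
  show ?case by (simp add: padic_int_def nat_pow_def)
next
  case (Suc n)
  have "(x [^]\<^bsub>padic_int p\<^esub> Suc n) k = (x [^]\<^bsub>padic_int p\<^esub> n) k * x k mod int p ^ k"
    by (simp add: padic_int_def nat_pow_def)
  then show ?case
    by (simp add: Suc.IH mod_simps mult.commute)
qed

lemma padic_int_minus_component:
  assumes "p > 0" and x: "x \<in> carrier (padic_int p)"
  shows "(\<ominus>\<^bsub>padic_int p\<^esub> x) k = (- x k) mod int p ^ k"
proof -
  interpret cring "padic_int p" by (rule cring_padic_int) fact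
  have "((\<ominus>\<^bsub>padic_int p\<^esub> x) \<oplus>\<^bsub>padic_int p\<^esub> x) k = 0"
    using l_neg[OF x] by (simp add: padic_int_def)
  then have "((\<ominus>\<^bsub>padic_int p\<^esub> x) k + x k) mod int p ^ k = 0"
    by (simp add: padic_int_def)
  then have "(\<ominus>\<^bsub>padic_int p\<^esub> x) k mod int p ^ k = (- x k) mod int p ^ k"
    by (simp add: mod_eq_dvd_iff dvd_eq_mod_eq_0)
  then show ?thesis
    using padic_int_component_mod[OF a_inv_closed[OF x]] by simp
qed

lemma padic_int_add_pow_nat_component:
  fixes n :: nat
  shows "([n] \<cdot>\<^bsub>padic_int p\<^esub> x) k = int n * x k mod int p ^ k"
proof (induction n)
  case 0
  show ?case by (simp add: padic_int_def add_pow_def nat_pow_def)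
next
  case (Suc n)
  have "([Suc n] \<cdot>\<^bsub>padic_int p\<^esub> x) k = (([n] \<cdot>\<^bsub>padic_int p\<^esub> x) k + x k) mod int p ^ k"
    by (simp add: padic_int_def add_pow_def nat_pow_def)
  then show ?case
    by (simp add: Suc.IH mod_simps algebra_simps)
qed

lemma padic_int_add_pow_int_component:
  fixes z :: int
  assumes "p > 0" and x: "x \<in> carrier (padic_int p)"
  shows "([z] \<cdot>\<^bsub>padic_int p\<^esub> x) k = z * x k mod int p ^ k"
proof -
  interpret cring "padic_int p" by (rule cring_padic_int) fact
  show ?thesis
  proof (cases "z \<ge> 0")
    case True
    then show ?thesis
      using padic_int_add_pow_nat_component[of p "nat z" x k] by (simp add: add_pow_int_ge)
  next
    case False
    then have "[z] \<cdot>\<^bsub>padic_int p\<^esub> x = \<ominus>\<^bsub>padic_int p\<^esub> ([nat (- z)] \<cdot>\<^bsub>padic_int p\<^esub> x)"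
      by (simp add: add_pow_int_lt)
    then show ?thesis
      using False x \<open>p > 0\<close>
      by (simp add: padic_int_minus_component padic_int_add_pow_nat_component mod_simps)
  qed
qed

lemma padic_int_finsum_component:
  assumes "p > 0" and "finite A" and "\<And>i. i \<in> A \<Longrightarrow> g i \<in> carrier (padic_int p)"
  shows "(\<Oplus>\<^bsub>padic_int p\<^esub>i \<in> A. g i) k = (\<Sum>i \<in> A. g i k) mod int p ^ k"
proof -
  interpret cring "padic_int p" by (rule cring_padic_int) fact
  from assms(2,3) show ?thesis
  proof (induction A rule: finite_induct)
    case empty
    have "\<zero>\<^bsub>padic_int p\<^esub> k = 0" by (simp add: padic_int_def)
    then show ?case by simp
  next
    case (insert j A)
    then have "(\<Oplus>\<^bsub>padic_int p\<^esub>i \<in> insert j A. g i)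
        = g j \<oplus>\<^bsub>padic_int p\<^esub> (\<Oplus>\<^bsub>padic_int p\<^esub>i \<in> A. g i)"
      by (intro finsum_insert) auto
    then have "(\<Oplus>\<^bsub>padic_int p\<^esub>i \<in> insert j A. g i) k = (g j k + (\<Oplus>\<^bsub>padic_int p\<^esub>i \<in> A. g i) k) mod int p ^ k"
      by (simp add: padic_int_def)
    then show ?case
      using insert by (simp add: mod_simps)
  qed
qed

lemma int_poly_eval_padic_int:
  assumes "p > 0" and x: "x \<in> carrier (padic_int p)"
  shows "int_poly_eval (padic_int p) f x k = poly f (x k) mod int p ^ k"
proof -
  interpret cring "padic_int p" by (rule cring_padic_int) fact
  have "int_poly_eval (padic_int p) f x k
      = (\<Sum>i\<le>degree f. coeff f i * (x k ^ i mod int p ^ k) mod int p ^ k) mod int p ^ k"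
    using assms unfolding int_poly_eval_def
    by (subst padic_int_finsum_component)
      (auto simp: padic_int_add_pow_int_component padic_int_nat_pow_component)
  also have "\<dots> = poly f (x k) mod int p ^ k"
    by (simp add: poly_altdef mod_sum_eq mod_simps)
  finally show ?thesis .
qed

lemma padic_int_roots_iff:
  assumes "p > 0"
  shows "x \<in> padic_int_roots p f \<longleftrightarrow>
    x \<in> carrier (padic_int p) \<and> (\<forall>k. int p ^ k dvd poly f (x k))"
proof (cases "x \<in> carrier (padic_int p)")
  case True
  have "int_poly_eval (padic_int p) f x = \<zero>\<^bsub>padic_int p\<^esub> \<longleftrightarrow>
      (\<forall>k. int_poly_eval (padic_int p) f x k = 0)"
    by (auto simp: padic_int_def)
  with True assms show ?thesis
    by (simp add: padic_int_roots_def int_poly_eval_padic_int dvd_eq_mod_eq_0)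
qed (simp add: padic_int_roots_def)


section \<open>Finiteness of the set of roots\<close>

lemma dvd_poly_diff:
  fixes f :: "int poly"
  assumes "m dvd x - y"
  shows "m dvd poly f x - poly f y"
proof (induction f)
  case 0
  show ?case by simp
next
  case (pCons c f)
  have "poly (pCons c f) x - poly (pCons c f) y
      = (x - y) * poly f x + y * (poly f x - poly f y)"
    by (simp add: algebra_simps)
  then show ?case
    using assms pCons.IH by simp
qed

lemma dvd_poly_cong:
  fixes f :: "int poly"
  assumes "m dvd x - y"
  shows "m dvd poly f x \<longleftrightarrow> m dvd poly f y"
  using dvd_add_right_iff[OF dvd_poly_diff[OF assms], of f "poly f y"] by simp

lemma prime_power_dvd_mult_cases:
  fixes q :: int
  assumes "prime q" and "q ^ (k + l) dvd u * v"
  shows "q ^ k dvd u \<or> q ^ l dvd v"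
proof (cases "u = 0 \<or> v = 0")
  case False
  then have "k + l \<le> multiplicity q u + multiplicity q v"
    using assms multiplicity_geI[of "u * v" q "k + l"]
    by (auto simp: prime_elem_multiplicity_mult_distrib dest: not_prime_unit)
  then have "k \<le> multiplicity q u \<or> l \<le> multiplicity q v"
    by linarith
  then show ?thesis
    by (auto intro: multiplicity_dvd')
qed auto

text \<open>In effect, \<open>\<int>\<^sub>p\<close> has no zero divisors.\<close>

lemma padic_int_roots_mult:
  assumes "prime p"
  shows "padic_int_roots p (f * g) = padic_int_roots p f \<union> padic_int_roots p g"
proof
  note roots_iff = padic_int_roots_iff[OF prime_gt_0_nat[OF assms]]
  show "padic_int_roots p f \<union> padic_int_roots p g \<subseteq> padic_int_roots p (f * g)"
    by (auto simp: roots_iff)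
  show "padic_int_roots p (f * g) \<subseteq> padic_int_roots p f \<union> padic_int_roots p g"
  proof (rule subsetI, rule ccontr)
    fix x
    assume fg: "x \<in> padic_int_roots p (f * g)"
      and notin: "x \<notin> padic_int_roots p f \<union> padic_int_roots p g"
    then have x: "x \<in> carrier (padic_int p)" by (simp add: roots_iff)
    with notin obtain k l where
      k: "\<not> int p ^ k dvd poly f (x k)" and l: "\<not> int p ^ l dvd poly g (x l)"
      by (auto simp: roots_iff)
    \<comment> \<open>Non-divisibility persists at higher precision, so both failures can be compared at \<open>k + l\<close>.\<close>
    have "\<not> int p ^ k dvd poly f (x (k + l))" "\<not> int p ^ l dvd poly g (x (k + l))"
      using k l dvd_poly_cong[OF padic_int_coherent[OF x, of k "k + l"], of f]
        dvd_poly_cong[OF padic_int_coherent[OF x, of l "k + l"], of g]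
      by simp_all
    moreover have "int p ^ (k + l) dvd poly f (x (k + l)) * poly g (x (k + l))"
      using fg unfolding roots_iff poly_mult by blast
    ultimately show False
      using assms prime_power_dvd_mult_cases[of "int p"] by auto
  qed
qed

lemma padic_int_roots_one:
  assumes "prime p"
  shows "padic_int_roots p 1 = {}"
proof -
  have "\<not> int p ^ 1 dvd poly 1 z" for z
    using assms by auto
  then show ?thesis
    using padic_int_roots_iff[OF prime_gt_0_nat[OF assms]] by blast
qed

lemma padic_int_roots_linear_unique:
  assumes p: "prime p" and ab: "gcd a b = 1"
    and x: "x \<in> padic_int_roots p [:b, a:]" and y: "y \<in> padic_int_roots p [:b, a:]"
  shows "x = y"
proof
  fix k
  note roots_iff = padic_int_roots_iff[OF prime_gt_0_nat[OF p]]
  have p': "prime (int p)" using p by simp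
  have dvd: "int p ^ k dvd b + x k * a" "int p ^ k dvd b + y k * a" for k
    using x y by (simp_all add: roots_iff)
  have "\<not> int p dvd a"
  proof
    assume pa: "int p dvd a"
    then have "int p dvd b"
      using dvd(1)[of 1] by (simp add: dvd_add_left_iff)
    with pa have "int p dvd 1"
      using ab by (metis gcd_greatest)
    then show False using p' not_prime_unit by blast
  qed
  then have cop: "coprime (int p ^ k) a"
    using p' by (simp add: prime_imp_coprime)
  have "int p ^ k dvd (x k - y k) * a"
    using dvd_diff[OF dvd(1)[of k] dvd(2)[of k]] by (simp add: algebra_simps)
  then have "int p ^ k dvd x k - y k"
    using cop by (simp add: coprime_dvd_mult_left_iff)
  then have "x k mod int p ^ k = y k mod int p ^ k"
    by (simp add: mod_eq_dvd_iff)
  then show "x k = y k"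
    using x y by (simp add: roots_iff padic_int_component_mod)
qed

lemma finite_padic_int_roots_prod_linear:
  assumes p: "prime p" and "finite A" and "\<And>i. i \<in> A \<Longrightarrow> gcd (a i) (b i) = 1"
  shows "finite (padic_int_roots p (\<Prod>i \<in> A. [:b i, a i:]))"
  using assms(2,3)
proof (induction A rule: finite_induct)
  case empty
  show ?case by (simp add: padic_int_roots_one[OF p])
next
  case (insert j A)
  have "padic_int_roots p [:b j, a j:] \<subseteq> {x}" if "x \<in> padic_int_roots p [:b j, a j:]" for x
    using padic_int_roots_linear_unique[OF p insert.prems[of j]] that by blast
  then have "finite (padic_int_roots p [:b j, a j:])"
    by (metis finite.emptyI finite_insert finite_subset all_not_in_conv)
  with insert show ?case
    by (simp add: padic_int_roots_mult[OF p] del: mult_pCons_left)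
qed


section \<open>Digit sequences and \<open>p\<close>-adic expansions\<close>

text \<open>Sequences of base-\<open>p\<close> digits, with no condition on their eventual behaviour.\<close>

definition digit_seqs :: "nat \<Rightarrow> (nat \<Rightarrow> nat) set" where
  "digit_seqs p = {c. \<forall>i. c i < p}"

text \<open>The natural number with the base-\<open>p\<close> digits \<open>c 0, \<dots>, c (k - 1)\<close>, least significant first.\<close>

definition digit_sum :: "nat \<Rightarrow> (nat \<Rightarrow> nat) \<Rightarrow> nat \<Rightarrow> nat" where
  "digit_sum p c k = (\<Sum>i<k. c i * p ^ i)"

lemma digit_sum_0 [simp]: "digit_sum p c 0 = 0"
  by (simp add: digit_sum_def)

lemma digit_sum_Suc [simp]: "digit_sum p c (Suc k) = digit_sum p c k + c k * p ^ k"
  by (simp add: digit_sum_def)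

lemma digit_sum_less:
  assumes "c \<in> digit_seqs p"
  shows "digit_sum p c k < p ^ k"
proof (induction k)
  case (Suc k)
  have "Suc (c k) \<le> p"
    using assms by (simp add: digit_seqs_def Suc_leI)
  then have "Suc (c k) * p ^ k \<le> p ^ Suc k"
    unfolding power_Suc by (rule mult_le_mono1)
  with Suc.IH show ?case by simp
qed simp

text \<open>The \<open>p\<close>-adic integer \<open>\<Sum>i. c i * p ^ i\<close>.\<close>

definition padic_of_digits :: "nat \<Rightarrow> (nat \<Rightarrow> nat) \<Rightarrow> nat \<Rightarrow> int" where
  "padic_of_digits p c = (\<lambda>k. int (digit_sum p c k))"

lemma padic_expansion_iff:
  "padic_expansion p x c \<longleftrightarrow> c \<in> digit_seqs p \<and> x = padic_of_digits p c"
  by (auto simp: padic_expansion_def digit_seqs_def padic_of_digits_def digit_sum_def)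

lemma padic_of_digits_in_carrier:
  assumes "c \<in> digit_seqs p"
  shows "padic_of_digits p c \<in> carrier (padic_int p)"
  unfolding padic_int_carrier_iff
proof (intro allI conjI)
  fix k
  show "padic_of_digits p c k < int p ^ k"
    using digit_sum_less[OF assms, of k] by (simp add: padic_of_digits_def flip: of_nat_power)
  then show "padic_of_digits p c (Suc k) mod int p ^ k = padic_of_digits p c k"
    by (simp add: padic_of_digits_def)
qed (simp add: padic_of_digits_def)

lemma padic_of_digits_bij:
  assumes "p > 0"
  shows "bij_betw (padic_of_digits p) (digit_seqs p) (carrier (padic_int p))"
proof (rule bij_betw_imageI)
  show "inj_on (padic_of_digits p) (digit_seqs p)"
  proof (rule inj_onI, rule ext)
    fix c d k
    assume "padic_of_digits p c = padic_of_digits p d"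
    then have eq: "digit_sum p c k = digit_sum p d k" for k
      by (auto simp: padic_of_digits_def fun_eq_iff)
    from eq[of "Suc k"] eq[of k] show "c k = d k"
      using assms by simp
  qed
next
  have "x \<in> padic_of_digits p ` digit_seqs p" if x: "x \<in> carrier (padic_int p)" for x
  proof
    \<comment> \<open>As \<open>x (Suc k)\<close> is below \<open>p ^ Suc k\<close> and reduces to \<open>x k\<close>, its quotient by \<open>p ^ k\<close> is the digit
      of order \<open>k\<close>.\<close>
    define c where "c k = nat (x (Suc k) div int p ^ k)" for k
    have pos: "int p ^ k > 0" for k using assms by simp
    have bounds: "0 \<le> x k" "x k < int p ^ k" "x (Suc k) mod int p ^ k = x k" for k
      using x by (simp_all add: padic_int_carrier_iff)
    have c: "int (c k) = x (Suc k) div int p ^ k" for k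
      unfolding c_def using bounds pos by (simp add: pos_imp_zdiv_nonneg_iff)
    have "x (Suc k) div int p ^ k < int p" for k
    proof (rule ccontr)
      assume "\<not> x (Suc k) div int p ^ k < int p"
      then have "int p * int p ^ k \<le> x (Suc k) div int p ^ k * int p ^ k"
        using pos[of k] by (intro mult_right_mono) auto
      also have "\<dots> \<le> x (Suc k)"
        using pos[of k] div_mult_mod_eq[of "x (Suc k)" "int p ^ k"] bounds by (smt (verit))
      finally show False
        using bounds(2)[of "Suc k"] by simp
    qed
    then have "int (c k) < int p" for k
      unfolding c .
    then show "c \<in> digit_seqs p"
      by (simp add: digit_seqs_def)
    show "x = padic_of_digits p c"
    proof
      fix k
      show "x k = padic_of_digits p c k"
      proof (induction k)
        case 0
        show ?case using bounds[of 0] by (simp add: padic_of_digits_def)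
      next
        case (Suc k)
        have "x (Suc k) = int (c k) * int p ^ k + x k"
          using bounds(3)[of k] c[of k] by (metis div_mult_mod_eq)
        with Suc show ?case by (simp add: padic_of_digits_def)
      qed
    qed
  qed
  then show "padic_of_digits p ` digit_seqs p = carrier (padic_int p)"
    using padic_of_digits_in_carrier by blast
qed

lemma padic_int_roots_eq_image:
  assumes "p > 0"
  shows "padic_int_roots p f
    = padic_of_digits p ` {c \<in> digit_seqs p. padic_of_digits p c \<in> padic_int_roots p f}"
  using padic_of_digits_bij[OF assms]
  by (auto simp: bij_betw_def padic_int_roots_def)


section \<open>Nodes and branches\<close>

text \<open>The path that picks the digit \<open>c k\<close> at the node at level \<open>k\<close>.\<close>

definition branch_of_digits :: "(nat \<Rightarrow> nat) \<Rightarrow> nat \<Rightarrow> nat list" where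
  "branch_of_digits c = (\<lambda>k. map c [0..<k])"

lemma inj_branch_of_digits: "inj branch_of_digits"
proof (rule injI, rule ext)
  fix c d k
  assume "branch_of_digits c = branch_of_digits d"
  then have "branch_of_digits c (Suc k) ! k = branch_of_digits d (Suc k) ! k" by simp
  then show "c k = d k" by (simp add: branch_of_digits_def del: upt_Suc)
qed

lemma node_indices_branch_of_digits:
  "node_indices p (branch_of_digits c k) = {digit_sum p c k + n * p ^ k | n. True}"
  by (simp add: node_indices_def branch_of_digits_def digit_sum_def)

lemma branch_of_digits_corresponds: "branch_corresponds p (branch_of_digits c) c"
  by (simp add: branch_corresponds_def node_indices_branch_of_digits digit_sum_def)

lemma digit_sum_in_node:
  assumes "k \<le> j"
  shows "digit_sum p c j \<in> node_indices p (branch_of_digits c k)"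
  using assms
proof (induction j rule: dec_induct)
  case base
  have "digit_sum p c k = digit_sum p c k + 0 * p ^ k" by simp
  then show ?case unfolding node_indices_branch_of_digits by blast
next
  case (step j)
  then obtain n where n: "digit_sum p c j = digit_sum p c k + n * p ^ k"
    by (auto simp: node_indices_branch_of_digits)
  have "p ^ j = p ^ (j - k) * p ^ k"
    using step.hyps by (simp flip: power_add)
  then have "digit_sum p c (Suc j) = digit_sum p c k + (n + c j * p ^ (j - k)) * p ^ k"
    using n by (simp add: algebra_simps)
  then show ?case unfolding node_indices_branch_of_digits by blast
qed

lemma infinite_node_indices:
  assumes "p > 0"
  shows "infinite (node_indices p cs)"
proof -
  let ?h = "\<lambda>n. (\<Sum>i<length cs. cs ! i * p ^ i) + n * p ^ length cs"
  have "inj ?h" using assms by (auto intro: injI)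
  then have "infinite (range ?h)" by (rule range_inj_infinite)
  moreover have "range ?h = node_indices p cs" by (auto simp: node_indices_def)
  ultimately show ?thesis by simp
qed

lemma padic_valuation_of_int:
  "padic_valuation p (of_int z) = (if z = 0 then \<infinity> else Fin (int (multiplicity (int p) z)))"
  by (simp add: padic_valuation_def)

lemma padic_valuation_cong:
  assumes "int p ^ k dvd z - w" and "\<not> int p ^ k dvd z"
  shows "padic_valuation p (of_int z) = padic_valuation p (of_int w)"
proof -
  have iff: "int p ^ j dvd z \<longleftrightarrow> int p ^ j dvd w" if "j \<le> k" for j
  proof -
    have "int p ^ j dvd z - w"
      using assms(1) that by (meson dvd_trans le_imp_power_dvd)
    then show ?thesis using dvd_add_right_iff[of "int p ^ j" "z - w" w] by simp
  qed
  then have w: "\<not> int p ^ k dvd w" using assms(2) by simp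
  have "int p ^ j dvd z \<longleftrightarrow> int p ^ j dvd w" for j
    using iff assms(2) w by (meson dvd_trans le_imp_power_dvd nle_le)
  then have "multiplicity (int p) z = multiplicity (int p) w"
    by (rule multiplicity_cong)
  moreover have "z \<noteq> 0" "w \<noteq> 0" using assms(2) w by auto
  ultimately show ?thesis by (simp add: padic_valuation_of_int)
qed

lemma padic_valuation_large:
  assumes "prime p" and "int p ^ k dvd z"
  shows "z = 0 \<or> multiplicity (int p) z \<ge> k"
  using assms by (auto intro!: multiplicity_geI dest: not_prime_unit)

lemma terminating_if_not_root:
  assumes "\<not> int p ^ k dvd poly f (padic_of_digits p c k)"
  shows "terminating p (\<lambda>n. of_int (poly f (int n))) (branch_of_digits c k)"
proof -
  have "padic_valuation p (of_int (poly f (int m)))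
      = padic_valuation p (of_int (poly f (padic_of_digits p c k)))"
    if m: "m \<in> node_indices p (branch_of_digits c k)" for m
  proof -
    have "int p ^ k dvd padic_of_digits p c k - int m"
      using m by (auto simp: node_indices_branch_of_digits padic_of_digits_def)
    then have "int p ^ k dvd poly f (padic_of_digits p c k) - poly f (int m)"
      by (rule dvd_poly_diff)
    then show ?thesis
      using assms by (intro padic_valuation_cong[symmetric])
  qed
  then show ?thesis by (simp add: terminating_def)
qed

lemma not_terminating_if_root:
  assumes p: "prime p" and "f \<noteq> 0"
    and root: "\<And>k. int p ^ k dvd poly f (padic_of_digits p c k)"
  shows "\<not> terminating p (\<lambda>n. of_int (poly f (int n))) (branch_of_digits c k)"
proof
  let ?I = "node_indices p (branch_of_digits c k)"
  assume const: "terminating p (\<lambda>n. of_int (poly f (int n))) (branch_of_digits c k)"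
  have "finite {z. poly f z = 0}" using \<open>f \<noteq> 0\<close> by (rule poly_roots_finite)
  then have "finite {n. poly f (int n) = 0}"
    using finite_vimageI[of "{z. poly f z = 0}" int] by (simp add: vimage_def inj_def)
  moreover have "infinite ?I" using p by (simp add: infinite_node_indices prime_gt_0_nat)
  ultimately have "\<not> ?I \<subseteq> {n. poly f (int n) = 0}"
    using finite_subset by blast
  then obtain m where m: "m \<in> ?I" "poly f (int m) \<noteq> 0"
    by blast
  \<comment> \<open>A level at which the partial sum lies in the node and has a value of larger valuation than
    \<open>f(m)\<close>.\<close>
  define j where "j = max k (Suc (multiplicity (int p) (poly f (int m))))"
  let ?z = "poly f (int (digit_sum p c j))"
  have "digit_sum p c j \<in> ?I" by (rule digit_sum_in_node) (simp add: j_def)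
  with const m have eq: "padic_valuation p (of_int ?z) = padic_valuation p (of_int (poly f (int m)))"
    unfolding terminating_def by blast
  have "?z = 0 \<or> multiplicity (int p) ?z \<ge> j"
    using p root[of j] by (intro padic_valuation_large) (simp_all add: padic_of_digits_def)
  with eq m show False
    by (auto simp: padic_valuation_of_int j_def split: if_splits)
qed

lemma infinite_branches_eq_nonterminating:
  "infinite_branches p S
    = branch_of_digits ` {c \<in> digit_seqs p. \<forall>k. \<not> terminating p S (branch_of_digits c k)}"
proof (intro equalityI subsetI)
  fix N
  assume N: "N \<in> infinite_branches p S"
  then have "\<forall>k. \<exists>c<p. N (Suc k) = N k @ [c]"
    by (simp add: infinite_branches_def)
  then obtain c where c: "\<And>k. c k < p" "\<And>k. N (Suc k) = N k @ [c k]"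
    by metis
  have "N k = branch_of_digits c k" for k
    using N by (induction k) (simp_all add: c branch_of_digits_def infinite_branches_def)
  then have "N = branch_of_digits c" by blast
  with N c(1) show
    "N \<in> branch_of_digits ` {c \<in> digit_seqs p. \<forall>k. \<not> terminating p S (branch_of_digits c k)}"
    by (auto simp: digit_seqs_def infinite_branches_def)
next
  fix N
  assume "N \<in> branch_of_digits ` {c \<in> digit_seqs p. \<forall>k. \<not> terminating p S (branch_of_digits c k)}"
  then obtain c where c: "c \<in> digit_seqs p" "N = branch_of_digits c"
    and nt: "\<And>k. \<not> terminating p S (N k)" by blast
  have Suc: "N (Suc k) = N k @ [c k]" for k
    by (simp add: c branch_of_digits_def)
  have N0: "N 0 = []" by (simp add: c branch_of_digits_def)
  have "N k \<in> valuation_tree p S" for k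
  proof (induction k)
    case 0
    show ?case unfolding N0 by (rule valuation_tree.root)
  next
    case (Suc k)
    show ?case unfolding \<open>N (Suc k) = N k @ [c k]\<close>
      using Suc nt c(1) by (intro valuation_tree.split) (simp_all add: digit_seqs_def)
  qed
  then show "N \<in> infinite_branches p S"
    using c(1) Suc N0 nt by (auto simp: infinite_branches_def digit_seqs_def)
qed

lemma infinite_branches_eq:
  assumes p: "prime p" and "f \<noteq> 0"
  shows "infinite_branches p (\<lambda>n. of_int (poly f (int n)))
    = branch_of_digits ` {c \<in> digit_seqs p. padic_of_digits p c \<in> padic_int_roots p f}"
proof -
  let ?S = "\<lambda>n. of_int (poly f (int n)) :: rat"
  have "(\<forall>k. \<not> terminating p ?S (branch_of_digits c k)) \<longleftrightarrow>
      padic_of_digits p c \<in> padic_int_roots p f" if "c \<in> digit_seqs p" for c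
    using terminating_if_not_root[of p _ f c] not_terminating_if_root[OF assms, of c]
      padic_of_digits_in_carrier[OF that] padic_int_roots_iff[OF prime_gt_0_nat[OF p]]
    by blast
  then show ?thesis
    unfolding infinite_branches_eq_nonterminating by (auto intro!: image_cong)
qed

theorem corollary5p3:
  fixes p r :: nat and a b :: "nat \<Rightarrow> int" and f :: "int poly" and S :: "nat \<Rightarrow> rat"
  assumes "prime p"
    and "\<And>i. i \<in> {1..r} \<Longrightarrow> a i \<noteq> 0"
    and "\<And>i. i \<in> {1..r} \<Longrightarrow> gcd (a i) (b i) = 1"
    and "f = (\<Prod>i = 1..r. [:b i, a i:])"
    and "\<And>n. S n = of_int (poly f (int n))"
  shows "finite (infinite_branches p S) \<and> finite (padic_int_roots p f)
    \<and> card (infinite_branches p S) = card (padic_int_roots p f)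
    \<and> (\<forall>N \<in> infinite_branches p S. \<exists>x \<in> padic_int_roots p f. \<exists>c.
          padic_expansion p x c \<and> branch_corresponds p N c)"
proof -
  have p0: "p > 0" using assms(1) by (rule prime_gt_0_nat)
  have "f \<noteq> 0" using assms(2) unfolding assms(4) by (auto simp: prod_zero_iff)
  let ?C = "{c \<in> digit_seqs p. padic_of_digits p c \<in> padic_int_roots p f}"
  have "S = (\<lambda>n. of_int (poly f (int n)))" using assms(5) by blast
  then have branches: "infinite_branches p S = branch_of_digits ` ?C"
    using infinite_branches_eq[OF assms(1) \<open>f \<noteq> 0\<close>] by simp
  have roots: "padic_int_roots p f = padic_of_digits p ` ?C"
    using p0 by (rule padic_int_roots_eq_image)
  have inj: "inj_on (padic_of_digits p) ?C"
    using bij_betw_imp_inj_on[OF padic_of_digits_bij[OF p0]] by (rule inj_on_subset) auto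
  have fin: "finite (padic_int_roots p f)"
    unfolding assms(4) using assms(1,3) by (intro finite_padic_int_roots_prod_linear) auto
  then have "finite ?C"
    using inj roots by (metis finite_imageD)
  then have "finite (infinite_branches p S)"
    unfolding branches by (rule finite_imageI)
  moreover have "card (infinite_branches p S) = card ?C"
    unfolding branches by (intro card_image inj_on_subset[OF inj_branch_of_digits]) simp
  moreover have "card (padic_int_roots p f) = card ?C"
    using card_image[OF inj] roots by simp
  moreover have "\<exists>x \<in> padic_int_roots p f. \<exists>c. padic_expansion p x c \<and> branch_corresponds p N c"
    if N: "N \<in> infinite_branches p S" for N
    using N branch_of_digits_corresponds unfolding branches padic_expansion_iff by blast
  ultimately show ?thesis using fin by simp
qed

end
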